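(* Let $\mathcal H$ be a nonzero real Hilbert space and $L>0$. Let $f:\mathcal H\to\mathbb R$ be convex, differentiable and $L$-smooth, and let $g:\mathcal H\to\mathbb R\cup\{+\infty\}$ be proper, closed and convex. Set $F=f+g$. Fix an integer $N\ge1$ and $R\ge0$, and suppose $x_\star,x_0\in\mathcal H$ satisfy $0\in\nabla f(x_\star)+\partial g(x_\star)$ and $\|x_0-x_\star\|\le R$. Starting from $y_0=x_0$, define for $0\le k<N$ $$y_{k+1}=\operatorname{prox}_{g/L}\Bigl(x_k-\tfrac1L\nabla f(x_k)\Bigr),\qquad x_{k+1}=y_{k+1}+\frac{k}{k+3}(y_{k+1}-y_k).$$ Then $$F(y_N)-F(x_\star)\le\frac{2LR^2}{N^2+5N+2}.$$
   Context: $L$-smooth means $\|\nabla f(x)-\nabla f(y)\|\le L\|x-y\|$ for all $x,y\in\mathcal H$. For proper closed convex $g$ and $\gamma>0$, $\operatorname{prox}_{\gamma g}(v)=\operatorname{arg\,min}_{w\in\mathcal H}\{\gamma g(w)+\frac12\|w-v\|^2\}$. $\partial g$ is the convex subdifferential. *)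

theory Defs
  imports "HOL-Analysis.Analysis"
begin

text \<open>The gradient is the Riesz representer of the derivative. It is unique
  when it exists; in a Hilbert space it exists wherever the function is
  (Frechet) differentiable.\<close>

definition gradient :: "('a::real_inner \<Rightarrow> real) \<Rightarrow> 'a \<Rightarrow> 'a" where
  "gradient f x = (THE v. GDERIV f x :> v)"

text \<open>Differentiability is a separate hypothesis, not part of this predicate.\<close>

definition L_smooth :: "real \<Rightarrow> ('a::real_inner \<Rightarrow> real) \<Rightarrow> bool" where
  "L_smooth L f \<longleftrightarrow> (\<forall>x y. norm (gradient f x - gradient f y) \<le> L * norm (x - y))"

definition epi :: "('a \<Rightarrow> ereal) \<Rightarrow> ('a \<times> real) set" where
  "epi g = {(x, r). g x \<le> ereal r}"

definition proper_fun :: "('a \<Rightarrow> ereal) \<Rightarrow> bool" where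
  "proper_fun g \<longleftrightarrow> (\<forall>x. g x \<noteq> -\<infinity>) \<and> (\<exists>x. g x \<noteq> \<infinity>)"

text \<open>Closedness and convexity of an extended-valued function are those of its epigraph.\<close>

definition closed_fun :: "('a::topological_space \<Rightarrow> ereal) \<Rightarrow> bool" where
  "closed_fun g \<longleftrightarrow> closed (epi g)"

definition convex_fun :: "('a::real_vector \<Rightarrow> ereal) \<Rightarrow> bool" where
  "convex_fun g \<longleftrightarrow> convex (epi g)"

text \<open>For proper \<open>g\<close> this set is empty at points where \<open>g\<close> is \<open>\<infinity>\<close>.\<close>

definition subdifferential :: "('a::real_inner \<Rightarrow> ereal) \<Rightarrow> 'a \<Rightarrow> 'a set" where
  "subdifferential g x = {v. \<forall>z. g x + ereal (v \<bullet> (z - x)) \<le> g z}"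

text \<open>For proper closed convex \<open>g\<close> on a Hilbert space and \<open>\<gamma> > 0\<close> the minimizer
  exists and is unique, so the choice made by \<^const>\<open>arg_min\<close> is immaterial.\<close>

definition prox :: "real \<Rightarrow> ('a::real_normed_vector \<Rightarrow> ereal) \<Rightarrow> 'a \<Rightarrow> 'a" where
  "prox \<gamma> g v = arg_min (\<lambda>w. ereal \<gamma> * g w + ereal (1/2 * (norm (w - v))\<^sup>2)) (\<lambda>_. True)"

end

theory Submission
  imports Defs
begin

text \<open>
  The bound is attained, up to scaling, by \<open>f = 0\<close> and \<open>g t = c * \<bar>t\<bar>\<close> on the real line: every
  proximal step moves by \<open>c\<close>, momentum adds to this, and with \<open>D = (N\<^sup>2 + 5 * N + 2) / 8\<close> and start
  \<open>2 * c * D\<close> the last iterate is \<open>c * D\<close>. A proof has to be an equality in this case. It combines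
  linearly the convexity inequalities available along the iteration:

  \<^item> for \<open>f\<close>, the gradient inequality between each gradient point and \<open>xstar\<close>, and the cocoercive
    inequality between consecutive points of the chain \<open>x 0, \<dots>, x (N - 1), y N\<close>
    (\<open>convex_gradient_inequality\<close>, \<open>smooth_convex_interpolation\<close>);
  \<^item> for \<open>g\<close>, the subgradient inequality between each \<open>y k\<close> and \<open>xstar\<close>, and between consecutive
    points of the chain \<open>y 1, \<dots>, y N\<close> (\<open>prox_subgradient\<close>).

  Demanding that the combination be stationary in every gradient at the worst case determines the
  weights: they are quotients of \<open>mass\<close> and \<open>height\<close>, defined below, and depend on \<open>N\<close>.

  With these weights the argument closes in three moves. After summation by parts the gradients of
  \<open>f\<close> enter only through differences of neighbouring gradients, and the cocoercivity terms bound
  them by completing squares (\<open>composite_certificate\<close>). What is left is a quadratic form in the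
  iterates. Expressed in the iterates divided by their worst-case heights, it couples only
  neighbours (\<open>step_identity\<close>); as it vanishes on constants, it is a combination of the squares
  \<open>\<parallel>v (k + 1) - v k\<parallel>\<^sup>2\<close>, which a potential makes visible (\<open>sum_residual_le\<close>). Finally all the coefficients
  have the right sign, a polynomial inequality in \<open>k\<close> and \<open>N\<close> (\<open>key_ineq\<close>).

  Two facts on Hilbert spaces make the objects meaningful: gradients exist, by the Riesz
  representation theorem, and proximal points exist. Both come from one minimisation principle
  (\<open>strongly_convex_minimizer_exists\<close>).
\<close>

section \<open>Convex functions with Lipschitz gradient\<close>

lemma has_derivative_along_line:
  fixes f :: "'a::real_inner \<Rightarrow> real"
  assumes "GDERIV f (x + t *\<^sub>R d) :> v"
  shows "((\<lambda>t. f (x + t *\<^sub>R d)) has_real_derivative (v \<bullet> d)) (at t)"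
proof -
  have "(f has_derivative (\<lambda>h. h \<bullet> v)) (at (x + t *\<^sub>R d))"
    using assms by (simp add: gderiv_def)
  moreover have "((\<lambda>t. x + t *\<^sub>R d) has_derivative (\<lambda>h. h *\<^sub>R d)) (at t)"
    by (auto intro!: derivative_eq_intros)
  ultimately have "((\<lambda>t. f (x + t *\<^sub>R d)) has_derivative (\<lambda>h. (h *\<^sub>R d) \<bullet> v)) (at t)"
    by (rule has_derivative_compose[rotated])
  then show ?thesis
    unfolding has_field_derivative_def by (simp add: inner_commute mult.commute[of _ "d \<bullet> v"])
qed

lemma convex_gradient_inequality:
  fixes f :: "'a::real_inner \<Rightarrow> real"
  assumes "convex_on UNIV f" and "GDERIV f x :> v"
  shows "f x + v \<bullet> (z - x) \<le> f z"
proof -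
  define h where "h t = f (x + t *\<^sub>R (z - x))" for t
  have "convex_on UNIV h"
  proof (rule convex_onI)
    fix t a b :: real assume "0 < t" "t < 1"
    have "x + ((1 - t) *\<^sub>R a + t *\<^sub>R b) *\<^sub>R (z - x)
      = (1 - t) *\<^sub>R (x + a *\<^sub>R (z - x)) + t *\<^sub>R (x + b *\<^sub>R (z - x))"
      by (simp add: algebra_simps)
    then show "h ((1 - t) *\<^sub>R a + t *\<^sub>R b) \<le> (1 - t) * h a + t * h b"
      unfolding h_def using convex_onD[OF assms(1), of t] \<open>0 < t\<close> \<open>t < 1\<close> by simp
  qed simp
  moreover have "(h has_real_derivative v \<bullet> (z - x)) (at 0)"
    using has_derivative_along_line[of f x 0 "z - x" v] assms(2) unfolding h_def by simp
  ultimately have "v \<bullet> (z - x) * (1 - 0) \<le> h 1 - h 0"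
    by (intro convex_on_imp_above_tangent[of UNIV h 0 1]) (auto intro: has_field_derivative_at_within)
  then show ?thesis by (simp add: h_def)
qed

lemma descent_lemma:
  fixes f :: "'a::real_inner \<Rightarrow> real"
  assumes grad: "\<And>x. GDERIV f x :> G x"
    and lip: "\<And>x y. norm (G x - G y) \<le> L * norm (x - y)"
  shows "f z \<le> f x + G x \<bullet> (z - x) + L / 2 * (norm (z - x))\<^sup>2"
proof -
  define d where "d = z - x"
  define h where "h t = f (x + t *\<^sub>R d) - t * (G x \<bullet> d) - L / 2 * t\<^sup>2 * (norm d)\<^sup>2" for t
  have "h 1 \<le> h 0"
  proof (rule DERIV_nonpos_imp_nonincreasing[of 0 1 h])
    fix t :: real assume t: "0 \<le> t" "t \<le> 1"
    have "(h has_real_derivative (G (x + t *\<^sub>R d) \<bullet> d - G x \<bullet> d - L * t * (norm d)\<^sup>2)) (at t)"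
      unfolding h_def by (auto intro!: derivative_eq_intros has_derivative_along_line[OF grad])
    moreover have "G (x + t *\<^sub>R d) \<bullet> d - G x \<bullet> d - L * t * (norm d)\<^sup>2 \<le> 0"
    proof -
      have "(G (x + t *\<^sub>R d) - G x) \<bullet> d \<le> norm (G (x + t *\<^sub>R d) - G x) * norm d"
        by (rule norm_cauchy_schwarz)
      also have "\<dots> \<le> (L * norm (t *\<^sub>R d)) * norm d"
        using lip[of "x + t *\<^sub>R d" x] by (intro mult_right_mono) auto
      finally show ?thesis using t by (simp add: inner_diff_left power2_eq_square algebra_simps)
    qed
    ultimately show "\<exists>y. (h has_real_derivative y) (at t) \<and> y \<le> 0" by blast
  qed simp
  then show ?thesis by (simp add: h_def d_def)
qed

text \<open>
  Go from \<open>z\<close> to the minimiser \<open>w\<close> of the quadratic upper model of \<open>f\<close> at \<open>z\<close> minus the tangent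
  at \<open>x\<close>: there the upper model still lies above that tangent, and the drop is the extra term.
\<close>

lemma smooth_convex_interpolation:
  fixes f :: "'a::real_inner \<Rightarrow> real"
  assumes "L > 0" and conv: "convex_on UNIV f" and grad: "\<And>x. GDERIV f x :> G x"
    and lip: "\<And>x y. norm (G x - G y) \<le> L * norm (x - y)"
  shows "f x + G x \<bullet> (z - x) + (norm (G z - G x))\<^sup>2 / (2 * L) \<le> f z"
proof -
  define e where "e = G z - G x"
  define w where "w = z - (1 / L) *\<^sub>R e"
  have "f x + G x \<bullet> (w - x) \<le> f w"
    by (rule convex_gradient_inequality[OF conv grad])
  also have "\<dots> \<le> f z + G z \<bullet> (w - z) + L / 2 * (norm (w - z))\<^sup>2"
    by (rule descent_lemma[OF grad lip])
  also have "(norm (w - z))\<^sup>2 = (norm e)\<^sup>2 / L\<^sup>2"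
    by (simp add: w_def power_divide)
  also have "L / 2 * ((norm e)\<^sup>2 / L\<^sup>2) = (norm e)\<^sup>2 / (2 * L)"
    using \<open>L > 0\<close> by (simp add: power2_eq_square)
  also have "w - z = - (1 / L) *\<^sub>R e" by (simp add: w_def)
  finally have "f x + G x \<bullet> (z - x) + (G z - G x) \<bullet> ((1 / L) *\<^sub>R e) - (norm e)\<^sup>2 / (2 * L) \<le> f z"
    by (simp add: w_def inner_simps diff_divide_distrib)
  moreover have "(G z - G x) \<bullet> ((1 / L) *\<^sub>R e) = 2 * ((norm e)\<^sup>2 / (2 * L))"
    using \<open>L > 0\<close> by (simp add: e_def power2_norm_eq_inner)
  ultimately have "f x + G x \<bullet> (z - x) + (norm e)\<^sup>2 / (2 * L) \<le> f z" by linarith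
  then show ?thesis by (simp add: e_def)
qed

section \<open>Minimisation in Hilbert space: gradients and proximal points\<close>

text \<open>
  Minimisation over a closed convex set of pairs, thought of as an epigraph, covers both the
  proximal point of an extended-valued function and the Riesz representer of a functional. A
  minimising sequence is Cauchy because at a midpoint the square drops by a quarter of the squared
  distance, while the value cannot fall below the infimum.
\<close>

lemma strongly_convex_minimizer_exists:
  fixes C :: "('a::{real_inner,banach} \<times> real) set"
  assumes "closed C" "convex C" "C \<noteq> {}" "c > 0"
    and bdd: "\<And>w r. (w, r) \<in> C \<Longrightarrow> b \<le> r + c / 2 * (norm (w - v))\<^sup>2"
  obtains w r where "(w, r) \<in> C"
    "\<And>w' r'. (w', r') \<in> C \<Longrightarrow> r + c / 2 * (norm (w - v))\<^sup>2 \<le> r' + c / 2 * (norm (w' - v))\<^sup>2"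
proof -
  define \<Phi> where "\<Phi> p = snd p + c / 2 * (norm (fst p - v))\<^sup>2" for p :: "'a \<times> real"
  define m where "m = (INF p\<in>C. \<Phi> p)"
  have bb: "bdd_below (\<Phi> ` C)"
    using bdd by (intro bdd_belowI2[of _ b]) (auto simp: \<Phi>_def)
  have m_le: "m \<le> \<Phi> p" if "p \<in> C" for p
    unfolding m_def by (rule cINF_lower[OF bb that])
  have "\<exists>p\<in>C. \<Phi> p < m + 1 / real (Suc n)" for n
    using cINF_less_iff[OF \<open>C \<noteq> {}\<close> bb, of "m + 1 / real (Suc n)"] by (simp add: m_def)
  then obtain p where p: "\<And>n. p n \<in> C" "\<And>n. \<Phi> (p n) < m + 1 / real (Suc n)" by metis
  define w where "w n = fst (p n)" for n
  have close: "c / 4 * (norm (w i - w j))\<^sup>2 \<le> 1 / real (Suc i) + 1 / real (Suc j)" for i j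
  proof -
    define q where "q = (1/2) *\<^sub>R p i + (1/2) *\<^sub>R p j"
    have "q \<in> C"
      unfolding q_def using p(1) \<open>convex C\<close> by (intro convexD) auto
    have parallelogram: "(norm (w i - v))\<^sup>2 + (norm (w j - v))\<^sup>2
      = 2 * (norm (fst q - v))\<^sup>2 + (norm (w i - w j))\<^sup>2 / 2"
    proof -
      have "fst q - v = (1/2) *\<^sub>R ((w i - v) + (w j - v))"
        by (simp add: q_def w_def algebra_simps flip: scaleR_add_left)
      moreover have "w i - w j = (w i - v) - (w j - v)" by simp
      moreover have "(norm a)\<^sup>2 + (norm b)\<^sup>2 = 2 * (norm ((1/2) *\<^sub>R (a + b)))\<^sup>2 + (norm (a - b))\<^sup>2 / 2" for a b :: 'a
        by (simp only: power2_norm_eq_inner) (simp add: inner_simps inner_commute field_simps)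
      ultimately show ?thesis by metis
    qed
    have "c / 2 * (norm (w i - v))\<^sup>2 + c / 2 * (norm (w j - v))\<^sup>2
        = c / 2 * ((norm (w i - v))\<^sup>2 + (norm (w j - v))\<^sup>2)"
      by (simp only: distrib_left)
    also have "\<dots> = 2 * (c / 2 * (norm (fst q - v))\<^sup>2) + c / 4 * (norm (w i - w j))\<^sup>2"
      unfolding parallelogram by (simp add: distrib_left)
    finally have "\<Phi> (p i) + \<Phi> (p j) = 2 * \<Phi> q + c / 4 * (norm (w i - w j))\<^sup>2"
      by (simp add: \<Phi>_def w_def) (simp add: q_def)
    then show ?thesis using m_le[OF \<open>q \<in> C\<close>] p(2)[of i] p(2)[of j] by linarith
  qed
  have "Cauchy w"
  proof (rule CauchyI)
    fix e :: real assume "e > 0"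
    obtain n where n: "1 / real (Suc n) < c / 8 * e\<^sup>2"
      using \<open>e > 0\<close> \<open>c > 0\<close> nat_approx_posE[of "c / 8 * e\<^sup>2"] by (metis divide_pos_pos mult_pos_pos zero_less_numeral zero_less_power)
    have "norm (w i - w j) < e" if "i \<ge> n" "j \<ge> n" for i j
    proof -
      have "1 / real (Suc i) \<le> 1 / real (Suc n)" "1 / real (Suc j) \<le> 1 / real (Suc n)"
        using that by (auto intro!: divide_left_mono)
      then have "c / 4 * (norm (w i - w j))\<^sup>2 < c / 4 * e\<^sup>2"
        using close[of i j] n by linarith
      then have "(norm (w i - w j))\<^sup>2 < e\<^sup>2" using \<open>c > 0\<close> by simp
      then show ?thesis using \<open>e > 0\<close> by (simp add: power2_less_imp_less)
    qed
    then show "\<exists>n. \<forall>i\<ge>n. \<forall>j\<ge>n. norm (w i - w j) < e" by blast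
  qed
  then obtain l where l: "w \<longlonglongrightarrow> l" using Cauchy_convergent convergent_def by blast
  have "(\<lambda>n. \<Phi> (p n)) \<longlonglongrightarrow> m"
  proof (rule tendsto_sandwich[of "\<lambda>_. m" _ _ "\<lambda>n. m + 1 / real (Suc n)"])
    show "(\<lambda>n. m + 1 / real (Suc n)) \<longlonglongrightarrow> m"
      using tendsto_add[OF tendsto_const[of m] LIMSEQ_inverse_real_of_nat] by (simp add: inverse_eq_divide)
  qed (auto intro!: always_eventually m_le p(1) less_imp_le[OF p(2)] simp del: of_nat_Suc)
  then have "(\<lambda>n. \<Phi> (p n) - c / 2 * (norm (w n - v))\<^sup>2) \<longlonglongrightarrow> m - c / 2 * (norm (l - v))\<^sup>2"
    by (intro tendsto_intros l)
  then have "(\<lambda>n. snd (p n)) \<longlonglongrightarrow> m - c / 2 * (norm (l - v))\<^sup>2"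
    by (simp add: \<Phi>_def w_def)
  then have "(\<lambda>n. (w n, snd (p n))) \<longlonglongrightarrow> (l, m - c / 2 * (norm (l - v))\<^sup>2)"
    by (rule tendsto_Pair[OF l])
  then have "p \<longlonglongrightarrow> (l, m - c / 2 * (norm (l - v))\<^sup>2)"
    by (simp add: w_def)
  then have "(l, m - c / 2 * (norm (l - v))\<^sup>2) \<in> C"
    using \<open>closed C\<close> p(1) by (metis closed_sequentially)
  then show ?thesis using m_le by (intro that) (force simp: \<Phi>_def)+
qed

text \<open>
  First-order optimality: moving a fraction \<open>t\<close> towards \<open>(w', r')\<close> changes the objective by
  \<open>t * (k + t * q)\<close>, and \<open>t\<close> tends to \<open>0\<close>.
\<close>

lemma minimizer_variational_inequality:
  fixes C :: "('a::real_inner \<times> real) set"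
  assumes "convex C" "(w, r) \<in> C" "(w', r') \<in> C"
    and min: "\<And>z s. (z, s) \<in> C \<Longrightarrow> r + c / 2 * (norm (w - v))\<^sup>2 \<le> s + c / 2 * (norm (z - v))\<^sup>2"
  shows "r + (c *\<^sub>R (v - w)) \<bullet> (w' - w) \<le> r'"
proof -
  define k where "k = r' - r - c * ((v - w) \<bullet> (w' - w))"
  define q where "q = c / 2 * (norm (w' - w))\<^sup>2"
  have "0 \<le> k + t * q" if "0 < t" "t < 1" for t
  proof -
    have "(1 - t) *\<^sub>R (w, r) + t *\<^sub>R (w', r') \<in> C"
      using assms(1-3) that by (intro convexD) auto
    then have "((w + t *\<^sub>R (w' - w)), r + t * (r' - r)) \<in> C"
      by (simp add: algebra_simps)
    from min[OF this] have "0 \<le> t * (r' - r) + c / 2 * ((norm (w + t *\<^sub>R (w' - w) - v))\<^sup>2 - (norm (w - v))\<^sup>2)"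
      by (simp add: algebra_simps)
    also have "(norm (w + t *\<^sub>R (w' - w) - v))\<^sup>2 - (norm (w - v))\<^sup>2
      = t * (t * (norm (w' - w))\<^sup>2 - 2 * ((v - w) \<bullet> (w' - w)))"
    proof -
      have "(norm (a + t *\<^sub>R b))\<^sup>2 - (norm a)\<^sup>2 = t * (t * (norm b)\<^sup>2 + 2 * (a \<bullet> b))" for a b :: 'a
        by (simp add: power2_norm_eq_inner inner_simps inner_commute algebra_simps)
      from this[of "w - v" "w' - w"] show ?thesis by (simp add: inner_diff_left algebra_simps)
    qed
    also have "t * (r' - r) + c / 2 * (t * (t * (norm (w' - w))\<^sup>2 - 2 * ((v - w) \<bullet> (w' - w)))) = t * (k + t * q)"
      by (simp add: k_def q_def algebra_simps)
    finally show ?thesis using that by (simp add: zero_le_mult_iff)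
  qed
  then have "\<forall>\<^sub>F t in at_right 0. 0 \<le> k + t * q"
    by (auto simp: eventually_at_right_field intro!: exI[of _ 1])
  moreover have "((\<lambda>t. k + t * q) \<longlongrightarrow> k + 0 * q) (at_right 0)"
    by (intro tendsto_intros)
  ultimately have "0 \<le> k"
    using tendsto_lowerbound[of "\<lambda>t. k + t * q" "k + 0 * q" "at_right 0" 0] by simp
  then show ?thesis by (simp add: k_def)
qed

text \<open>
  The representer is the minimiser of \<open>\<parallel>w\<parallel>\<^sup>2 / 2 - l w\<close>.
\<close>

lemma riesz_representation:
  fixes l :: "'a::{real_inner,banach} \<Rightarrow> real"
  assumes "bounded_linear l"
  obtains w where "\<And>h. l h = h \<bullet> w"
proof -
  interpret bounded_linear l by fact
  obtain K where K: "\<And>x. norm (l x) \<le> norm x * K" using bounded by blast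
  define C where "C = {p. - l (fst p) \<le> snd p}"
  have cl: "closed C"
    unfolding C_def by (intro closed_Collect_le continuous_intros continuous_on linear_continuous_on assms)
  have co: "convex C"
  proof (rule convexI)
    fix p q and s t :: real
    assume "p \<in> C" "q \<in> C" "0 \<le> s" "0 \<le> t"
    then have "s * - l (fst p) \<le> s * snd p" "t * - l (fst q) \<le> t * snd q"
      unfolding C_def mem_Collect_eq by (blast intro: mult_left_mono)+
    then show "s *\<^sub>R p + t *\<^sub>R q \<in> C" by (simp add: C_def add scale)
  qed
  have lb: "- (K\<^sup>2 / 2) \<le> r + 1 / 2 * (norm (w - 0))\<^sup>2" if "(w, r) \<in> C" for w r
  proof -
    have "- (norm w * K) \<le> r" using that K[of w] by (simp add: C_def abs_le_iff)
    moreover have "0 \<le> (norm w - K)\<^sup>2" by simp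
    ultimately show ?thesis by (simp add: power2_diff)
  qed
  have ne: "C \<noteq> {}" by (auto simp: C_def)
  obtain w r where w: "(w, r) \<in> C"
    "\<And>w' r'. (w', r') \<in> C \<Longrightarrow> r + 1 / 2 * (norm (w - 0))\<^sup>2 \<le> r' + 1 / 2 * (norm (w' - 0))\<^sup>2"
    using strongly_convex_minimizer_exists[OF cl co ne zero_less_one lb] by blast
  have r: "r = - l w" using w(1) w(2)[of w "- l w"] by (simp add: C_def)
  have le: "l h \<le> h \<bullet> w" for h
    using minimizer_variational_inequality[OF co w(1) _ w(2), of "w + h" "- l (w + h)"]
    by (simp add: C_def r add inner_commute)
  have "l h = h \<bullet> w" for h
    using le[of h] le[of "- h"] by (simp add: neg)
  then show ?thesis by (rule that)
qed

lemma GDERIV_gradient: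
  fixes f :: "'a::{real_inner,banach} \<Rightarrow> real"
  assumes "f differentiable (at x)"
  shows "GDERIV f x :> gradient f x"
proof -
  obtain l where l: "(f has_derivative l) (at x)" using assms by (auto simp: differentiable_def)
  obtain w where w: "\<And>h. l h = h \<bullet> w"
    using riesz_representation[OF has_derivative_bounded_linear[OF l]] by blast
  have "l = (\<lambda>h. h \<bullet> w)" using w by auto
  then have D: "GDERIV f x :> w" using l by (simp add: gderiv_def)
  have "v = w" if "GDERIV f x :> v" for v
  proof -
    have "(\<lambda>h. h \<bullet> v) = (\<lambda>h. h \<bullet> w)"
      using has_derivative_unique that D unfolding gderiv_def by blast
    then have "(v - w) \<bullet> v = (v - w) \<bullet> w" by meson
    then have "(v - w) \<bullet> (v - w) = 0" by (simp add: inner_diff_right)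
    then show ?thesis by simp
  qed
  then show ?thesis unfolding gradient_def using D by (metis theI)
qed

text \<open>
  The subgradient \<open>v\<close> supplies the affine minorant that bounds the proximal objective from below.
  The objective in the definition of \<^const>\<open>prox\<close> is the one used here divided by \<open>L\<close>.
\<close>

lemma prox_subgradient:
  fixes g :: "'a::{real_inner,banach} \<Rightarrow> ereal" and z :: 'a
  assumes "L > 0" and g: "proper_fun g" "closed_fun g" "convex_fun g" and "v \<in> subdifferential g x"
  defines "p \<equiv> prox (1 / L) g z"
  shows "\<bar>g p\<bar> \<noteq> \<infinity>" and "L *\<^sub>R (z - p) \<in> subdifferential g p"
proof -
  define C where "C = epi g"
  define \<Phi> where "\<Phi> w = ereal (1 / L) * g w + ereal (1/2 * (norm (w - z))\<^sup>2)" for w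
  have C_iff: "(w, r) \<in> C \<longleftrightarrow> g w \<le> ereal r" for w r by (simp add: C_def epi_def)
  have C: "closed C" "convex C" using g by (simp_all add: C_def closed_fun_def convex_fun_def)
  have not_minf: "g w \<noteq> - \<infinity>" for w using g(1) by (auto simp: proper_fun_def)
  obtain w0 where "g w0 \<noteq> \<infinity>" using g(1) by (auto simp: proper_fun_def)
  then obtain r0 where r0: "g w0 = ereal r0" using not_minf[of w0] by (cases "g w0") auto
  then have "(w0, r0) \<in> C" by (simp add: C_iff)
  then have ne: "C \<noteq> {}" by blast
  have sub: "g x + ereal (v \<bullet> (w - x)) \<le> g w" for w using assms(5) by (simp add: subdifferential_def)
  then obtain rx where rx: "g x = ereal rx" using not_minf[of x] sub[of w0] r0 by (cases "g x") auto
  \<comment> \<open>The bound is the minimum of the affine minorant plus the quadratic, by completing the square.\<close>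
  have lb: "rx + v \<bullet> (z - x) - (norm v)\<^sup>2 / (2 * L) \<le> r + L / 2 * (norm (w - z))\<^sup>2" if "(w, r) \<in> C" for w r
  proof -
    have "ereal (rx + v \<bullet> (w - x)) \<le> ereal r"
      using order_trans[OF sub[of w], of "ereal r"] that by (simp add: C_iff rx)
    then have "rx + v \<bullet> (w - x) \<le> r" by simp
    moreover have "0 \<le> L / 2 * (norm (w - z + (1 / L) *\<^sub>R v))\<^sup>2" using \<open>L > 0\<close> by simp
    moreover have "L / 2 * (norm (w - z + (1 / L) *\<^sub>R v))\<^sup>2
      = L / 2 * (norm (w - z))\<^sup>2 + v \<bullet> (w - z) + (norm v)\<^sup>2 / (2 * L)"
      using \<open>L > 0\<close> by (simp add: power2_norm_eq_inner inner_simps inner_commute field_simps)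
    ultimately show ?thesis by (simp add: inner_diff_right)
  qed
  have \<Phi>_real: "\<Phi> w = ereal ((r + L / 2 * (norm (w - z))\<^sup>2) / L)" if "g w = ereal r" for w r
    using that \<open>L > 0\<close> by (simp add: \<Phi>_def field_simps)
  have \<Phi>_inf: "\<Phi> w = \<infinity>" if "g w = \<infinity>" for w
    using that \<open>L > 0\<close> by (simp add: \<Phi>_def)
  obtain q s where q: "(q, s) \<in> C"
    "\<And>w r. (w, r) \<in> C \<Longrightarrow> s + L / 2 * (norm (q - z))\<^sup>2 \<le> r + L / 2 * (norm (w - z))\<^sup>2"
    using strongly_convex_minimizer_exists[OF C ne \<open>L > 0\<close> lb] by blast
  obtain gq where gq: "g q = ereal gq" using q(1) not_minf[of q] by (cases "g q") (auto simp: C_iff)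
  have "is_arg_min \<Phi> (\<lambda>_. True) q"
  proof -
    have "\<Phi> q \<le> \<Phi> w" for w
    proof (cases "g w")
      case (real r)
      have "gq \<le> s" using q(1) by (simp add: C_iff gq)
      then have "gq + L / 2 * (norm (q - z))\<^sup>2 \<le> r + L / 2 * (norm (w - z))\<^sup>2"
        using q(2)[of w r] real by (simp add: C_iff)
      then show ?thesis using \<open>L > 0\<close> by (simp add: \<Phi>_real[OF gq] \<Phi>_real[OF real] divide_right_mono)
    qed (use not_minf[of w] \<Phi>_inf[of w] in auto)
    then show ?thesis by (simp add: is_arg_min_def not_less)
  qed
  then have "is_arg_min \<Phi> (\<lambda>_. True) p"
    unfolding p_def prox_def arg_min_def \<Phi>_def by (rule someI)
  then have min: "\<Phi> p \<le> \<Phi> w" for w by (auto simp: is_arg_min_def not_less)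
  have "g p \<noteq> \<infinity>" using \<Phi>_inf[of p] min[of w0] \<Phi>_real[OF r0] by auto
  then obtain gp where gp: "g p = ereal gp" using not_minf[of p] by (cases "g p") auto
  then show "\<bar>g p\<bar> \<noteq> \<infinity>" by simp
  have min': "gp + L / 2 * (norm (p - z))\<^sup>2 \<le> r + L / 2 * (norm (w - z))\<^sup>2" if wr: "(w, r) \<in> C" for w r
  proof -
    obtain gw where gw: "g w = ereal gw" "gw \<le> r"
      using wr not_minf[of w] by (cases "g w") (auto simp: C_iff)
    show ?thesis using min[of w] gw(2) \<open>L > 0\<close>
      by (simp add: \<Phi>_real[OF gp] \<Phi>_real[OF gw(1)] divide_le_cancel)
  qed
  have "g p + ereal ((L *\<^sub>R (z - p)) \<bullet> (w - p)) \<le> g w" for w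
  proof (cases "g w")
    case (real r)
    then show ?thesis
      using minimizer_variational_inequality[OF C(2) _ _ min', of w r] by (simp add: C_iff gp)
  qed (use not_minf[of w] in auto)
  then show "L *\<^sub>R (z - p) \<in> subdifferential g p" by (simp add: subdifferential_def)
qed

section \<open>The weights of the certificate\<close>

text \<open>
  The numerators of the weights in the certificate. The increments of this sequence satisfy the
  linear recursion \<open>increment_recursion\<close> below, which expresses that the certificate is stationary
  along the worst case; of the solutions with values \<open>0\<close> and \<open>4\<close> at \<open>0\<close> and \<open>1\<close>, this is the one whose
  last increment, from \<open>N\<close> to \<open>N + 1\<close>, is zero.
\<close>

definition mass :: "nat \<Rightarrow> nat \<Rightarrow> real" where
  "mass N k = real k * (real k + 3)
     - (real k - 1) * real k * (real k + 1) * (real k + 2) / (2 * (real N * (real N + 1)))"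

text \<open>
  The position of \<open>y k\<close>, for \<open>1 \<le> k \<le> N\<close> and in units of \<open>c\<close>, in the worst case
  \<open>f = 0\<close>, \<open>g t = c * \<bar>t\<bar>\<close>, \<open>L = 1\<close> on the real line with start \<open>2 * c * height N N\<close>.
  There every proximal step moves by exactly \<open>c\<close>.
\<close>

definition height :: "nat \<Rightarrow> nat \<Rightarrow> real" where
  "height N k = ((real N)\<^sup>2 + 5 * real N + 1 - real k * (real k + 5) / 2) / 4"

lemma mass_0 [simp]: "mass N 0 = 0" and mass_1: "mass N (Suc 0) = 4"
  by (simp_all add: mass_def)

lemma mass_Suc:
  "mass N (Suc k) - mass N k
     = 2 * (real k + 2) * (1 - real k * (real k + 1) / (real N * (real N + 1)))"
proof -
  define q where "q = 1 / (2 * (real N * (real N + 1)))"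
  have "mass N n = real n * (real n + 3) - (real n - 1) * real n * (real n + 1) * (real n + 2) * q" for n
    by (simp add: mass_def q_def)
  moreover have "real k * (real k + 1) / (real N * (real N + 1)) = real k * (real k + 1) * (2 * q)"
    by (simp add: q_def)
  ultimately show ?thesis by (simp only: of_nat_Suc) (simp add: algebra_simps)
qed

lemma mass_mono_Suc:
  assumes "k \<le> N"
  shows "mass N k \<le> mass N (Suc k)"
proof -
  have "real k * (real k + 1) \<le> real N * (real N + 1)"
    using assms by (intro mult_mono) auto
  then have "real k * (real k + 1) / (real N * (real N + 1)) \<le> 1"
    by (cases "N = 0") simp_all
  then have "0 \<le> 2 * (real k + 2) * (1 - real k * (real k + 1) / (real N * (real N + 1)))"
    by (intro mult_nonneg_nonneg) auto
  then show ?thesis using mass_Suc[of N k] by linarith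
qed

lemma mass_nonneg: "k \<le> N \<Longrightarrow> mass N k \<ge> 0"
proof (induction k)
  case (Suc k)
  then show ?case using mass_mono_Suc[of k N] by linarith
qed simp

lemma mass_pos:
  assumes "0 < k" "k \<le> N" shows "mass N k > 0"
  using assms
proof (induction k rule: nat_induct_non_zero)
  case (Suc k)
  then show ?case using mass_mono_Suc[of k N] by linarith
qed (simp add: mass_1)

lemma height_N: "height N N = ((real N)\<^sup>2 + 5 * real N + 2) / 8"
  unfolding height_def by (simp add: field_simps power2_eq_square)

lemma mass_N: "N \<ge> 1 \<Longrightarrow> mass N N = 4 * height N N"
proof -
  assume "N \<ge> 1"
  then have eq: "(real N - 1) * real N * (real N + 1) * (real N + 2) / (2 * (real N * (real N + 1)))
     = (real N - 1) * (real N + 2) / 2"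
    by (simp add: divide_simps) (simp add: algebra_simps)
  show ?thesis
    unfolding mass_def height_N eq by (simp add: field_simps power2_eq_square)
qed

lemma height_Suc: "height N (Suc k) = height N k - (real k + 3) / 4"
  unfolding height_def by (simp add: field_simps)

lemma height_pos:
  assumes "k \<le> N" shows "height N k > 0"
proof -
  have "real k * (real k + 5) \<le> real N * (real N + 5)"
    using assms by (intro mult_mono) auto
  moreover have "0 \<le> real N * (real N + 5)" by simp
  moreover have "4 * height N k = real N * (real N + 5) + 1 - real k * (real k + 5) / 2"
    unfolding height_def by (simp add: power2_eq_square distrib_left mult.commute)
  ultimately show ?thesis by linarith
qed

text \<open>
  This is \<open>key_ineq\<close> with the denominators cleared and a factor \<open>k\<close> removed, where \<open>c\<close> stands for
  \<open>k\<close>, \<open>n\<close> for \<open>N\<close> and \<open>T\<close> for four times the height at \<open>k + 1\<close>. The inequality is nearly sharp for \<open>k\<close> close to \<open>N\<close>: the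
  leading terms cancel. Measuring \<open>N\<close> by its distance \<open>b\<close> from \<open>k + 2\<close> makes every coefficient
  nonnegative.
\<close>

lemma key_poly:
  fixes c b :: real
  assumes "c \<ge> 0" "b \<ge> 0"
  defines "n \<equiv> c + b + 2"
  defines "J \<equiv> 2 * (n * (n + 1))"
  defines "T \<equiv> n\<^sup>2 + 5 * n + 1 - (c + 1) * (c + 6) / 2"
  shows "0 \<le> (c+3)\<^sup>2 * T * (T - c) * (J * (c + 3) - (c + 2) * (c + 1) * (c - 1))
    + (T + c + 3) * ((c + 3) * (T - c) * (c + 1) * (J * (c + 4) - (c + 3) * (c + 2) * c)
                   - (2 * c + 3) * T * (c + 2) * (J * (c + 5) - (c + 4) * (c + 3) * (c + 1)))"
    (is "0 \<le> ?E")
proof -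
  have "?E = (15/4*c^7 + 115*c^6 + 1384*c^5 + 16997/2*c^4 + 116433/4*c^3 + 112293/2*c^2 + 56808*c + 23328)
    + (35*c^6 + 1645/2*c^5 + 14783/2*c^4 + 66199/2*c^3 + 157443/2*c^2 + 94842*c + 45360) * b
    + (223/2*c^5 + 3905/2*c^4 + 26031/2*c^3 + 82683/2*c^2 + 62649*c + 36234) * b^2
    + (156*c^4 + 2138*c^3 + 10412*c^2 + 21300*c + 15390) * b^3
    + (133*c^3 + 1298*c^2 + 3909*c + 3600) * b^4
    + (60*c^2 + 338*c + 414) * b^5 + (10*c + 18) * b^6"
    unfolding T_def J_def n_def by algebra
  also have "\<dots> \<ge> 0"
    using assms(1,2) by (intro add_nonneg_nonneg mult_nonneg_nonneg) auto
  finally show ?thesis .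
qed

text \<open>
  What remains of two consecutive steps, after all cancellations, is a multiple of
  \<open>\<parallel>v (k + 1) - v k\<parallel>\<^sup>2\<close>; this inequality says that the multiple has the right sign.
\<close>

lemma key_ineq:
  assumes "Suc (Suc k) \<le> N"
  shows "real k / (real k + 3) * height N k *
     (mass N (Suc (Suc k)) * ((2 * real k + 3) / (real k + 3) * height N (Suc k)) / (height N (Suc (Suc k)) + 1)
       - mass N (Suc k)) \<le> mass N k * height N (Suc k)" (is "?l \<le> ?r")
proof -
  obtain m where N: "N = k + 2 + m" using assms by (auto simp: le_iff_add)
  define c b n where "c = real k" and "b = real m" and "n = c + b + 2"
  define J where "J = 2 * (n * (n + 1))"
  define T where "T = n\<^sup>2 + 5 * n + 1 - (c + 1) * (c + 6) / 2"
  have c: "c \<ge> 0" "b \<ge> 0" by (auto simp: c_def b_def)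
  have n: "real N = n" by (simp add: N n_def c_def b_def)
  have J: "J > 0" using c by (simp add: J_def n_def)
  have h1: "height N (Suc k) = T / 4"
    unfolding height_def n T_def by (simp add: c_def algebra_simps)
  have h0: "height N k = (T + c + 3) / 4" and h2: "height N (Suc (Suc k)) + 1 = (T - c) / 4"
    using height_Suc[of N k] height_Suc[of N "Suc k"] by (simp_all add: h1 c_def field_simps)
  have Tc: "T - c > 0" using h2 height_pos[OF assms] by simp
  define P0 P1 P2 where "P0 = J * (c + 3) - (c + 2) * (c + 1) * (c - 1)"
    and "P1 = J * (c + 4) - (c + 3) * (c + 2) * c"
    and "P2 = J * (c + 5) - (c + 4) * (c + 3) * (c + 1)"
  have m0: "mass N k = c * P0 / J" and m1: "mass N (Suc k) = (c + 1) * P1 / J"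
   and m2: "mass N (Suc (Suc k)) = (c + 2) * P2 / J"
    using J unfolding mass_def n P0_def P1_def P2_def J_def[symmetric]
    by (simp_all add: c_def[symmetric] field_simps)
  have "?r - ?l = c * ((c+3)\<^sup>2 * T * (T - c) * P0 + (T + c + 3) * ((c + 3) * (T - c) * (c + 1) * P1
                   - (2 * c + 3) * T * (c + 2) * P2)) / (4 * J * (c+3)\<^sup>2 * (T - c))"
    unfolding h0 h1 h2 m0 m1 m2 c_def[symmetric] using J c Tc
    by (simp add: divide_simps) algebra
  also have "\<dots> \<ge> 0"
    using key_poly[OF c, folded n_def, folded J_def T_def, folded P0_def P1_def P2_def] c J Tc
    by (intro divide_nonneg_nonneg mult_nonneg_nonneg) auto
  finally show ?thesis by simp
qed

text \<open>
  The condition under which the multiples of \<open>\<parallel>v (k + 1)\<parallel>\<^sup>2\<close> produced by neighbouring steps cancel.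
\<close>

lemma increment_recursion:
  "(2 * real k + 3) / (real k + 3) * (mass N (Suc (Suc k)) - mass N (Suc k)) - (mass N (Suc k) - mass N k)
     = (real k + 1) / (real k + 4) * (mass N (Suc (Suc (Suc k))) - mass N (Suc (Suc k)))"
proof -
  define c where "c = real k"
  have c: "c \<ge> 0" by (simp add: c_def)
  define q where "q = inverse (real N * (real N + 1))"
  have "mass N (Suc (Suc (Suc k))) - mass N (Suc (Suc k)) = (c + 4) * (2 * (1 - (c + 2) * (c + 3) * q))"
    "mass N (Suc (Suc k)) - mass N (Suc k) = (c + 3) * (2 * (1 - (c + 1) * (c + 2) * q))"
    "mass N (Suc k) - mass N k = 2 * (c + 2) * (1 - c * (c + 1) * q)"
    unfolding mass_Suc divide_inverse q_def[symmetric] of_nat_Suc c_def[symmetric] by (algebra | rule refl)+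
  then show ?thesis using c unfolding c_def[symmetric]
    by simp (simp add: algebra_simps)
qed

lemma mass_last: "mass (Suc n) (Suc n) - mass (Suc n) n = 4"
proof -
  have eq: "real n * (real n + 1) / (real (Suc n) * (real (Suc n) + 1)) = real n / (real n + 2)"
    by (simp add: divide_simps) (simp add: algebra_simps)
  show ?thesis unfolding mass_Suc eq by (simp add: divide_simps)
qed

lemma mass_stationary: "N \<ge> 1 \<Longrightarrow> mass N (Suc N) = mass N N"
  using mass_Suc[of N N] by simp

section \<open>Chains of convexity inequalities\<close>

text \<open>
  Weight \<open>w (j + 1) - w j\<close> is given to the comparison of the \<open>j\<close>-th point with the reference point
  (placed at the origin), and the weight \<open>w j\<close> collected so far is transported from point \<open>j - 1\<close>
  to point \<open>j\<close>. The values at intermediate points then cancel, and only slopes remain. For \<open>j = 0\<close>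
  the truncated index \<open>j - 1\<close> is harmless because it is multiplied by \<open>w 0 = 0\<close>.
\<close>

lemma weighted_chain:
  fixes u \<gamma> :: "nat \<Rightarrow> 'a::real_inner" and \<phi> r w :: "nat \<Rightarrow> real"
  assumes w0: "w 0 = 0"
    and mono: "\<And>j. j \<le> n \<Longrightarrow> w j \<le> w (Suc j)"
    and star: "\<And>j. j \<le> n \<Longrightarrow> \<phi> j - c \<le> \<gamma> j \<bullet> u j"
    and chain: "\<And>j. j < n \<Longrightarrow> \<phi> (Suc j) \<le> \<phi> j + \<gamma> (Suc j) \<bullet> (u (Suc j) - u j) - r (Suc j)"
  shows "w (Suc n) * (\<phi> n - c)
     \<le> (\<Sum>j\<le>n. \<gamma> j \<bullet> (w (Suc j) *\<^sub>R u j - w j *\<^sub>R u (j - 1)) - w j * r j)"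
  using mono star chain
proof (induction n)
  case 0
  have "w 1 \<ge> 0" using 0(1)[of 0] w0 by simp
  then have "w 1 * (\<phi> 0 - c) \<le> w 1 * (\<gamma> 0 \<bullet> u 0)"
    using 0(2)[of 0] by (intro mult_left_mono) auto
  then show ?case by (simp add: w0)
next
  case (Suc n)
  have pos: "w j \<ge> 0" if "j \<le> Suc (Suc n)" for j
    using that
  proof (induction j)
    case (Suc j)
    then show ?case using Suc.prems(1) \<open>\<And>j. j \<le> Suc n \<Longrightarrow> w j \<le> w (Suc j)\<close>[of j] by simp
  qed (simp add: w0)
  have IH: "w (Suc n) * (\<phi> n - c)
     \<le> (\<Sum>j\<le>n. \<gamma> j \<bullet> (w (Suc j) *\<^sub>R u j - w j *\<^sub>R u (j - 1)) - w j * r j)"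
    using Suc.prems by (intro Suc.IH) auto
  have 1: "w (Suc n) * (\<phi> (Suc n) - c) \<le>
      w (Suc n) * (\<phi> n - c + \<gamma> (Suc n) \<bullet> (u (Suc n) - u n) - r (Suc n))"
    using Suc.prems(3)[of n] pos[of "Suc n"] by (intro mult_left_mono) auto
  have 2: "(w (Suc (Suc n)) - w (Suc n)) * (\<phi> (Suc n) - c)
     \<le> (w (Suc (Suc n)) - w (Suc n)) * (\<gamma> (Suc n) \<bullet> u (Suc n))"
    using Suc.prems(1,2)[of "Suc n"] by (intro mult_left_mono) auto
  have "w (Suc (Suc n)) * (\<phi> (Suc n) - c)
    = w (Suc n) * (\<phi> (Suc n) - c) + (w (Suc (Suc n)) - w (Suc n)) * (\<phi> (Suc n) - c)"
    by (simp add: algebra_simps)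
  also have "\<dots> \<le> w (Suc n) * (\<phi> n - c + \<gamma> (Suc n) \<bullet> (u (Suc n) - u n) - r (Suc n))
     + (w (Suc (Suc n)) - w (Suc n)) * (\<gamma> (Suc n) \<bullet> u (Suc n))"
    by (intro add_mono 1 2)
  also have "\<dots> = w (Suc n) * (\<phi> n - c) + (\<gamma> (Suc n) \<bullet> (w (Suc (Suc n)) *\<^sub>R u (Suc n) - w (Suc n) *\<^sub>R u n)
      - w (Suc n) * r (Suc n))"
    by (simp add: inner_simps algebra_simps)
  finally show ?case using IH by simp
qed

lemma summation_by_parts_inner:
  fixes \<gamma> p :: "nat \<Rightarrow> 'a::real_inner"
  assumes "p 0 = 0"
  shows "(\<Sum>j<n. \<gamma> j \<bullet> (p (Suc j) - p j)) = \<gamma> n \<bullet> p n - (\<Sum>j<n. p (Suc j) \<bullet> (\<gamma> (Suc j) - \<gamma> j))"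
proof (induction n)
  case (Suc n)
  then show ?case by (simp add: inner_simps inner_commute)
qed (simp add: assms)

lemma complete_square_bound:
  fixes p e :: "'a::real_inner"
  assumes "b > 0"
  shows "- (b *\<^sub>R p) \<bullet> e - b / 2 * (norm e)\<^sup>2 \<le> b / 2 * (norm p)\<^sup>2"
proof -
  have "0 \<le> b / 2 * (norm (p + e))\<^sup>2" using assms by simp
  also have "(norm (p + e))\<^sup>2 = (norm p)\<^sup>2 + 2 * (p \<bullet> e) + (norm e)\<^sup>2"
    by (simp add: power2_norm_eq_inner inner_simps inner_commute)
  finally show ?thesis by (simp add: algebra_simps)
qed

section \<open>A potential for the rescaled iterates\<close>

text \<open>
  One step of the method, where \<open>d\<close> is the proximal displacement and \<open>a\<close>, \<open>b\<close>, \<open>c\<close> are three successive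
  rescaled iterates. The particular factor \<open>m\<^sub>1 / (\<tau> + 1)\<close> eliminates the product of \<open>a\<close> and \<open>c\<close>, so
  that only squares of vectors and of neighbouring differences appear; this is what makes a
  telescoping potential possible.
\<close>

lemma step_identity:
  fixes a b c d :: "'a::real_inner" and \<alpha> \<beta> \<tau> m\<^sub>0 m\<^sub>1 :: real
  assumes "\<tau> + 1 > 0" and "\<beta> - \<alpha> = \<tau> + 1"
    and d: "d = \<beta> *\<^sub>R b - \<alpha> *\<^sub>R a - \<tau> *\<^sub>R c"
  shows "2 * (d \<bullet> (m\<^sub>1 *\<^sub>R c - m\<^sub>0 *\<^sub>R b)) + m\<^sub>1 / (\<tau> + 1) * (norm (d - c))\<^sup>2
    = - ((m\<^sub>1 - m\<^sub>0) * \<tau> - m\<^sub>1) * (norm c)\<^sup>2 + (m\<^sub>1 * \<beta> - m\<^sub>0 * (\<beta> + 1)) * (norm b)\<^sup>2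
      - (m\<^sub>1 - m\<^sub>0) * \<alpha> * (norm a)\<^sup>2 - m\<^sub>0 * \<tau> * (norm (c - b))\<^sup>2
      + \<alpha> * (m\<^sub>1 * \<beta> / (\<tau> + 1) - m\<^sub>0) * (norm (b - a))\<^sup>2"
proof -
  have t: "\<tau> = \<beta> - \<alpha> - 1" and nz: "\<beta> - \<alpha> \<noteq> 0" using assms by auto
  show ?thesis
    unfolding power2_norm_eq_inner d t inner_diff_left inner_diff_right inner_scaleR_left inner_scaleR_right
      inner_commute[of b a] inner_commute[of c a] inner_commute[of c b]
    using nz by (simp add: divide_simps) (simp add: algebra_simps)
qed

text \<open>
  The squares in \<open>step_identity\<close>, summed by parts. It involves the steps \<open>k\<close> and \<open>k + 1\<close>, and at \<open>k = 0\<close> the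
  terms with \<open>v 0\<close> vanish, since the first momentum coefficient and \<open>mass N 0\<close> are zero.
\<close>

definition potential :: "nat \<Rightarrow> (nat \<Rightarrow> 'a::real_inner) \<Rightarrow> nat \<Rightarrow> real" where
  "potential N v k =
     ((mass N (Suc k) - mass N k) * height N (Suc k) - mass N (Suc k)) * (norm (v (Suc k)))\<^sup>2
     - (mass N (Suc (Suc k)) - mass N (Suc k)) * (real k / (real k + 3) * height N k) * (norm (v k))\<^sup>2
     + mass N k * height N (Suc k) * (norm (v (Suc k) - v k))\<^sup>2"

text \<open>
  At the last step the coefficients of the two vectors vanish, because the final increment of
  \<open>mass\<close> is \<open>4\<close>, the next one is \<open>0\<close>, and \<open>mass N N = 4 * height N N\<close>. Only a square is left.
\<close>

lemma potential_final_nonneg: "potential (Suc n) v n \<ge> 0"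
proof -
  have "mass (Suc n) (Suc n) = 4 * height (Suc n) (Suc n)" by (simp add: mass_N)
  moreover have "mass (Suc n) (Suc (Suc n)) - mass (Suc n) (Suc n) = 0"
    using mass_stationary[of "Suc n"] by simp
  ultimately have "potential (Suc n) v n = mass (Suc n) n * height (Suc n) (Suc n) * (norm (v (Suc n) - v n))\<^sup>2"
    unfolding potential_def mass_last by simp
  then show ?thesis using mass_nonneg[of n "Suc n"] height_pos[of "Suc n" "Suc n"] by simp
qed

text \<open>
  Eight times what step \<open>k\<close> leaves in the certificate after the gradients of the smooth part have
  been maximised out.
\<close>

definition residual :: "nat \<Rightarrow> (nat \<Rightarrow> 'a::real_inner) \<Rightarrow> (nat \<Rightarrow> 'a) \<Rightarrow> nat \<Rightarrow> real" where
  "residual N d v k = 2 * (d k \<bullet> (mass N (Suc k) *\<^sub>R v (Suc k) - mass N k *\<^sub>R v k))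
     + mass N (Suc k) / (height N (Suc k) + 1) * (norm (d k - v (Suc k)))\<^sup>2"

text \<open>
  Divided by their worst-case heights, the iterates are constant in the worst case from the first
  step on, so every difference \<open>v (k + 1) - v k\<close> measures a departure from it and can only help. The first step has no
  predecessor and is an instance of \<open>step_identity\<close> with \<open>\<alpha> = 0\<close>; it is where the distance of the
  starting point enters.
\<close>

lemma sum_residual_le:
  fixes u y d v :: "nat \<Rightarrow> 'a::real_inner"
  assumes "n < N"
    and u0: "u 0 = y 0"
    and u_Suc: "\<And>k. Suc k < N \<Longrightarrow> u (Suc k) = y (Suc k) + (real k / (real k + 3)) *\<^sub>R (y (Suc k) - y k)"
  defines "d \<equiv> \<lambda>k. u k - y (Suc k)" and "v \<equiv> \<lambda>k. (1 / height N k) *\<^sub>R y k"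
  shows "(\<Sum>k\<le>n. residual N d v k) \<le> 2 / height N N * (norm (u 0))\<^sup>2 - potential N v n"
  using assms(1)
proof (induction n)
  case 0
  define t where "t = height N 1"
  have t: "t > 0" using height_pos[of 1 N] 0 by (simp add: t_def)
  \<comment> \<open>The first displacement in the worst case is one unit, from \<open>2 * height N N\<close> to \<open>height N 1\<close>.\<close>
  have tN: "2 * height N N = t + 1"
    unfolding height_N t_def height_def by (simp add: field_simps)
  have d: "d 0 = (t + 1) *\<^sub>R ((1 / (t + 1)) *\<^sub>R u 0) - 0 *\<^sub>R 0 - t *\<^sub>R v 1"
    using t by (simp add: d_def v_def t_def)
  have m: "mass N 1 = 4" using mass_1 by simp
  have "residual N d v 0 = - (4 * t - 4) * (norm (v 1))\<^sup>2 + 4 * (t + 1) * (norm ((1 / (t + 1)) *\<^sub>R u 0))\<^sup>2"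
    using step_identity[OF _ _ d, of 4 0] t m by (simp add: residual_def t_def)
  also have "4 * (t + 1) * (norm ((1 / (t + 1)) *\<^sub>R u 0))\<^sup>2 = 4 / (t + 1) * (norm (u 0))\<^sup>2"
  proof -
    have "4 * s * (norm ((1 / s) *\<^sub>R u 0))\<^sup>2 = 4 / s * (norm (u 0))\<^sup>2" if "s > 0" for s
      using that by (simp add: power_divide power2_eq_square)
    then show ?thesis by this (use t in simp)
  qed
  also have "4 / (t + 1) = 2 / height N N"
    unfolding tN[symmetric] by simp
  finally show ?case using m by (simp add: potential_def t_def algebra_simps)
next
  case (Suc n)
  define \<alpha> \<beta> \<tau> where "\<alpha> = real n / (real n + 3) * height N n"
    and "\<beta> = (2 * real n + 3) / (real n + 3) * height N (Suc n)"
    and "\<tau> = height N (Suc (Suc n))"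
  define \<sigma> where "\<sigma> = height N (Suc n)"
  have pos: "height N n > 0" "\<sigma> > 0" "\<tau> > 0"
    using Suc.prems height_pos[of _ N] by (auto simp: \<tau>_def \<sigma>_def)
  have h: "height N n = \<sigma> + (real n + 3) / 4" and t: "\<tau> = \<sigma> - (real n + 4) / 4"
    using height_Suc[of N n] height_Suc[of N "Suc n"] by (simp_all add: \<tau>_def \<sigma>_def)
  \<comment> \<open>Again the unit displacement of the worst case, now for \<open>u (n + 1) = \<beta> v (n + 1) - \<alpha> v n\<close>.\<close>
  have ba: "\<beta> - \<alpha> = \<tau> + 1"
    unfolding \<alpha>_def \<beta>_def \<sigma>_def[symmetric] h t by (simp add: divide_simps) (simp add: algebra_simps)
  have hb: "\<beta> *\<^sub>R v (Suc n) = ((2 * real n + 3) / (real n + 3)) *\<^sub>R y (Suc n)"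
    and ha: "\<alpha> *\<^sub>R v n = (real n / (real n + 3)) *\<^sub>R y n"
    and hc: "\<tau> *\<^sub>R v (Suc (Suc n)) = y (Suc (Suc n))"
    using pos by (simp_all add: v_def \<alpha>_def \<beta>_def \<tau>_def \<sigma>_def)
  have "(2 * real n + 3) / (real n + 3) = 1 + real n / (real n + 3)"
    by (simp add: field_simps)
  then have "u (Suc n) = ((2 * real n + 3) / (real n + 3)) *\<^sub>R y (Suc n) - (real n / (real n + 3)) *\<^sub>R y n"
    using u_Suc[OF Suc.prems] by (simp add: algebra_simps)
  then have d: "d (Suc n) = \<beta> *\<^sub>R v (Suc n) - \<alpha> *\<^sub>R v n - \<tau> *\<^sub>R v (Suc (Suc n))"
    unfolding hb ha hc by (simp add: d_def)
  note id = step_identity[OF _ ba d, of "mass N (Suc (Suc n))" "mass N (Suc n)"]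
  define A B C E G where "A = (norm (v n))\<^sup>2" and "B = (norm (v (Suc n)))\<^sup>2" and "C = (norm (v (Suc (Suc n))))\<^sup>2"
    and "E = (norm (v (Suc n) - v n))\<^sup>2" and "G = (norm (v (Suc (Suc n)) - v (Suc n)))\<^sup>2"
  define m0 m1 m2 m3 where "m0 = mass N n" and "m1 = mass N (Suc n)" and "m2 = mass N (Suc (Suc n))"
    and "m3 = mass N (Suc (Suc (Suc n)))"
  define \<kappa> where "\<kappa> = (real n + 1) / (real n + 4)"
  have rec: "\<beta> * (m2 - m1) - \<sigma> * (m1 - m0) = \<sigma> * \<kappa> * (m3 - m2)"
  proof -
    have "\<sigma> * ((2 * real n + 3) / (real n + 3) * (m2 - m1) - (m1 - m0)) = \<sigma> * (\<kappa> * (m3 - m2))"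
      unfolding m0_def m1_def m2_def m3_def \<kappa>_def increment_recursion ..
    then show ?thesis unfolding \<beta>_def \<sigma>_def[symmetric] by (simp add: algebra_simps)
  qed
  have key: "\<alpha> * (m2 * \<beta> / (\<tau> + 1) - m1) \<le> m0 * \<sigma>"
    using key_ineq[of n N] Suc.prems unfolding \<alpha>_def \<beta>_def \<tau>_def \<sigma>_def m0_def m1_def m2_def by simp
  have res: "residual N d v (Suc n) = - ((m2 - m1) * \<tau> - m2) * C + (m2 * \<beta> - m1 * (\<beta> + 1)) * B
      - (m2 - m1) * \<alpha> * A - m1 * \<tau> * G + \<alpha> * (m2 * \<beta> / (\<tau> + 1) - m1) * E"
    using id pos unfolding residual_def m0_def m1_def m2_def \<tau>_def A_def B_def C_def E_def G_def by simp
  have pot: "potential N v n = ((m1 - m0) * \<sigma> - m1) * B - (m2 - m1) * \<alpha> * A + m0 * \<sigma> * E"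
    unfolding potential_def m0_def m1_def m2_def A_def B_def E_def \<alpha>_def \<sigma>_def by simp
  have pot': "potential N v (Suc n) = ((m2 - m1) * \<tau> - m2) * C - (m3 - m2) * (\<kappa> * \<sigma>) * B + m1 * \<tau> * G"
    unfolding potential_def m1_def m2_def m3_def B_def C_def G_def \<kappa>_def \<sigma>_def \<tau>_def
    by (simp add: add.commute)
  have "residual N d v (Suc n) + potential N v (Suc n) - potential N v n
    = (\<beta> * (m2 - m1) - \<sigma> * (m1 - m0) - \<sigma> * \<kappa> * (m3 - m2)) * B
      + (\<alpha> * (m2 * \<beta> / (\<tau> + 1) - m1) - m0 * \<sigma>) * E"
    unfolding res pot pot' by (simp add: algebra_simps)
  also have "\<dots> \<le> 0"
    using key by (simp add: rec E_def mult_nonpos_nonneg)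
  finally show ?case using Suc by simp
qed

section \<open>The rate of convergence\<close>

text \<open>
  The estimate for \<open>L = 1\<close> and reference point \<open>0\<close>, using only values \<open>\<phi>\<close>, \<open>\<psi>\<close> and slopes \<open>\<gamma>\<close>, \<open>s\<close>. The
  points \<open>u\<close> are those at which the smooth part is used: the gradient points, followed by the output
  \<open>y N\<close>. The weights \<open>wf\<close> and \<open>wg\<close> of the two chains differ by one in the denominator. This makes
  \<open>p (j + 1)\<close> a multiple of \<open>d j - v (j + 1)\<close>, which is zero in the worst case, as it has to be: it
  is the coefficient of the free variable \<open>\<gamma> (j + 1) - \<gamma> j\<close>.
\<close>

lemma composite_certificate:
  fixes u y \<gamma> s :: "nat \<Rightarrow> 'a::real_inner" and \<phi> \<psi> :: "nat \<Rightarrow> real"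
  assumes N: "N \<ge> 1"
    and u0: "u 0 = y 0"
    and u_Suc: "\<And>k. Suc k < N \<Longrightarrow> u (Suc k) = y (Suc k) + (real k / (real k + 3)) *\<^sub>R (y (Suc k) - y k)"
    and uN: "u N = y N"
    and step: "\<And>k. k < N \<Longrightarrow> y (Suc k) = u k - \<gamma> k - s k"
    and f_star: "\<And>j. j \<le> N \<Longrightarrow> \<phi> j - \<phi>\<^sub>0 \<le> \<gamma> j \<bullet> u j"
    and f_chain: "\<And>j. j < N \<Longrightarrow>
       \<phi> (Suc j) \<le> \<phi> j + \<gamma> (Suc j) \<bullet> (u (Suc j) - u j) - (norm (\<gamma> (Suc j) - \<gamma> j))\<^sup>2 / 2"
    and g_star: "\<And>k. k < N \<Longrightarrow> \<psi> k - \<psi>\<^sub>0 \<le> s k \<bullet> y (Suc k)"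
    and g_chain: "\<And>k. Suc k < N \<Longrightarrow> \<psi> (Suc k) \<le> \<psi> k + s (Suc k) \<bullet> (y (Suc (Suc k)) - y (Suc k))"
  shows "\<phi> N + \<psi> (N - 1) - (\<phi>\<^sub>0 + \<psi>\<^sub>0) \<le> 2 / ((real N)\<^sup>2 + 5 * real N + 2) * (norm (u 0))\<^sup>2"
proof -
  obtain n where Nn: "N = Suc n" using N by (cases N) auto
  define wf where "wf j = (if j \<le> N then mass N j / (4 * (height N j + 1)) else 1)" for j
  define wg where "wg j = mass N j / (4 * height N j)" for j
  define d where "d k = u k - y (Suc k)" for k
  define v where "v k = (1 / height N k) *\<^sub>R y k" for k
  define r where "r j = (norm (\<gamma> j - \<gamma> (j - 1)))\<^sup>2 / 2" for j
  have w0: "wf 0 = 0" "wg 0 = 0" by (simp_all add: wf_def wg_def)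
  have wend: "wf (Suc N) = 1" "wg N = 1"
    using height_pos[of N N] mass_N[OF N] by (simp_all add: wf_def wg_def)
  have mono_f: "wf j \<le> wf (Suc j)" if "j \<le> N" for j
  proof (cases "j = N")
    case True
    then show ?thesis using height_pos[of N N] mass_N[OF N] by (simp add: wf_def)
  next
    case False
    moreover have "height N (Suc j) \<le> height N j" by (simp add: height_Suc)
    ultimately show ?thesis
      using that mass_mono_Suc[of j N] mass_nonneg[of j N] height_pos[of "Suc j" N]
      by (auto simp: wf_def intro!: frac_le)
  qed
  have mono_g: "wg j \<le> wg (Suc j)" if "j \<le> n" for j
  proof -
    have "height N (Suc j) \<le> height N j" by (simp add: height_Suc)
    then show ?thesis
      using that mass_mono_Suc[of j N] mass_nonneg[of j N] height_pos[of "Suc j" N] Nn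
      by (auto simp: wg_def intro!: frac_le)
  qed
  have F: "\<phi> N - \<phi>\<^sub>0 \<le> (\<Sum>j\<le>N. \<gamma> j \<bullet> (wf (Suc j) *\<^sub>R u j - wf j *\<^sub>R u (j - 1)) - wf j * r j)"
    using weighted_chain[of wf N \<phi> \<phi>\<^sub>0 \<gamma> u r] w0 mono_f f_star f_chain by (simp add: wend r_def)
  have "wg (Suc n) * (\<psi> n - \<psi>\<^sub>0) \<le> (\<Sum>j\<le>n. s j \<bullet> (wg (Suc j) *\<^sub>R y (Suc j) - wg j *\<^sub>R y (Suc (j - 1))) - wg j * 0)"
    using w0 mono_g g_star g_chain Nn by (intro weighted_chain[of wg n \<psi> \<psi>\<^sub>0 s "\<lambda>j. y (Suc j)" "\<lambda>_. 0"]) auto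
  also have "\<dots> = (\<Sum>j\<le>n. s j \<bullet> (wg (Suc j) *\<^sub>R y (Suc j) - wg j *\<^sub>R y j))"
    by (intro sum.cong refl) (auto simp: w0 split: nat_diff_split elim: not0_implies_Suc)
  finally have G: "\<psi> n - \<psi>\<^sub>0 \<le> (\<Sum>j<N. s j \<bullet> (wg (Suc j) *\<^sub>R y (Suc j) - wg j *\<^sub>R y j))"
    using wend by (simp add: Nn lessThan_Suc_atMost)
  define p where "p j = wf j *\<^sub>R u (j - 1) - wg j *\<^sub>R y j" for j
  have p0: "p 0 = 0" by (simp add: p_def w0)
  have p_Suc: "p (Suc j) = wf (Suc j) *\<^sub>R (d j - v (Suc j))" if "j < N" for j
  proof -
    have "m / (4 * h) = m / (4 * (h + 1)) * (1 + 1 / h)" if "h > 0" for m h :: real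
      using that by (simp add: divide_simps)
    then have "wg (Suc j) = wf (Suc j) * (1 + 1 / height N (Suc j))"
      using that height_pos[of "Suc j" N] by (simp add: wf_def wg_def)
    then show ?thesis by (simp add: p_def d_def v_def algebra_simps)
  qed
  have pN: "\<gamma> N \<bullet> (wf (Suc N) *\<^sub>R u N - wf N *\<^sub>R u (N - 1)) = - (\<gamma> N \<bullet> p N)"
    by (simp add: wend p_def uN inner_simps)
  \<comment> \<open>Substituting the optimality condition of the proximal step leaves \<open>\<gamma>\<close> only through its increments.\<close>
  have "\<phi> N + \<psi> n - (\<phi>\<^sub>0 + \<psi>\<^sub>0)
     \<le> (\<Sum>j<N. \<gamma> j \<bullet> (wf (Suc j) *\<^sub>R u j - wf j *\<^sub>R u (j - 1)))
       + \<gamma> N \<bullet> (wf (Suc N) *\<^sub>R u N - wf N *\<^sub>R u (N - 1)) - (\<Sum>j\<le>N. wf j * r j)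
       + (\<Sum>j<N. s j \<bullet> (wg (Suc j) *\<^sub>R y (Suc j) - wg j *\<^sub>R y j))"
    using F G by (simp add: sum_subtractf flip: lessThan_Suc_atMost)
  also have "(\<Sum>j\<le>N. wf j * r j) = (\<Sum>j<N. wf (Suc j) * r (Suc j))"
    unfolding Nn sum.atMost_Suc_shift by (simp add: w0 lessThan_Suc_atMost)
  also have "(\<Sum>j<N. s j \<bullet> (wg (Suc j) *\<^sub>R y (Suc j) - wg j *\<^sub>R y j))
      = (\<Sum>j<N. d j \<bullet> (wg (Suc j) *\<^sub>R y (Suc j) - wg j *\<^sub>R y j))
        - (\<Sum>j<N. \<gamma> j \<bullet> (wg (Suc j) *\<^sub>R y (Suc j) - wg j *\<^sub>R y j))"
  proof -
    have "s j = d j - \<gamma> j" if "j < N" for j using step[OF that] by (simp add: d_def)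
    then show ?thesis unfolding sum_subtractf[symmetric] by (intro sum.cong) (simp_all add: inner_diff_left)
  qed
  also have "(\<Sum>j<N. \<gamma> j \<bullet> (wf (Suc j) *\<^sub>R u j - wf j *\<^sub>R u (j - 1)))
     = (\<Sum>j<N. \<gamma> j \<bullet> (p (Suc j) - p j)) + (\<Sum>j<N. \<gamma> j \<bullet> (wg (Suc j) *\<^sub>R y (Suc j) - wg j *\<^sub>R y j))"
    unfolding sum.distrib[symmetric] by (intro sum.cong) (simp_all add: p_def inner_simps)
  also have "(\<Sum>j<N. \<gamma> j \<bullet> (p (Suc j) - p j)) = \<gamma> N \<bullet> p N - (\<Sum>j<N. p (Suc j) \<bullet> (\<gamma> (Suc j) - \<gamma> j))"
    by (rule summation_by_parts_inner[of p, OF p0])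
  finally have "\<phi> N + \<psi> n - (\<phi>\<^sub>0 + \<psi>\<^sub>0)
      \<le> (\<Sum>j<N. d j \<bullet> (wg (Suc j) *\<^sub>R y (Suc j) - wg j *\<^sub>R y j))
        + ((- (\<Sum>j<N. p (Suc j) \<bullet> (\<gamma> (Suc j) - \<gamma> j))) - (\<Sum>j<N. wf (Suc j) * r (Suc j)))"
    unfolding pN by linarith
  also have "\<dots> = (\<Sum>j<N. d j \<bullet> (wg (Suc j) *\<^sub>R y (Suc j) - wg j *\<^sub>R y j)
        + (- p (Suc j) \<bullet> (\<gamma> (Suc j) - \<gamma> j) - wf (Suc j) * r (Suc j)))"
    by (simp add: sum.distrib sum_subtractf sum_negf)
  \<comment> \<open>The cocoercivity terms absorb these increments.\<close>
  also have "\<dots> \<le> (\<Sum>j<N. residual N d v j / 8)"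
  proof (intro sum_mono)
    fix j assume "j \<in> {..<N}"
    then have j: "j < N" by simp
    have wg: "wg k *\<^sub>R y k = (mass N k / 4) *\<^sub>R v k" if "k \<le> N" for k
      using height_pos[OF that] by (simp add: wg_def v_def)
    have pos: "wf (Suc j) > 0" using mass_pos[of "Suc j" N] height_pos[of "Suc j" N] j by (simp add: wf_def)
    have "- p (Suc j) \<bullet> (\<gamma> (Suc j) - \<gamma> j) - wf (Suc j) * r (Suc j) \<le> wf (Suc j) / 2 * (norm (d j - v (Suc j)))\<^sup>2"
      using complete_square_bound[OF pos, of "d j - v (Suc j)" "\<gamma> (Suc j) - \<gamma> j"] by (simp add: p_Suc[OF j] r_def)
    moreover have "residual N d v j / 8 = d j \<bullet> (wg (Suc j) *\<^sub>R y (Suc j) - wg j *\<^sub>R y j)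
        + wf (Suc j) / 2 * (norm (d j - v (Suc j)))\<^sup>2"
      using j by (simp add: residual_def wg wf_def inner_diff_right add_divide_distrib diff_divide_distrib)
    ultimately show "d j \<bullet> (wg (Suc j) *\<^sub>R y (Suc j) - wg j *\<^sub>R y j)
        + (- p (Suc j) \<bullet> (\<gamma> (Suc j) - \<gamma> j) - wf (Suc j) * r (Suc j)) \<le> residual N d v j / 8"
      by simp
  qed
  also have "\<dots> = (\<Sum>j\<le>n. residual N d v j) / 8"
    by (simp add: sum_divide_distrib Nn lessThan_Suc_atMost)
  also have "\<dots> \<le> (2 / height N N * (norm (u 0))\<^sup>2 - potential N v n) / 8"
    using sum_residual_le[of n N u y, OF _ u0 u_Suc]
    by (simp add: Nn d_def[abs_def] v_def[abs_def])
  also have "\<dots> \<le> (2 / height N N * (norm (u 0))\<^sup>2) / 8"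
    using potential_final_nonneg[of n v] by (simp add: Nn)
  also have "\<dots> = 2 / ((real N)\<^sup>2 + 5 * real N + 2) * (norm (u 0))\<^sup>2"
  proof -
    have "2 / (s / 8) * a / 8 = 2 / s * a" for s a :: real by (cases "s = 0") simp_all
    then show ?thesis unfolding height_N .
  qed
  finally show ?thesis by (simp add: Nn)
qed

theorem theorem5p5:
  fixes f :: "'a::{real_inner, banach} \<Rightarrow> real"
    and g :: "'a \<Rightarrow> ereal"
    and F :: "'a \<Rightarrow> ereal"
    and L R :: real
    and N :: nat
    and x y :: "nat \<Rightarrow> 'a"
    and xstar :: 'a
  assumes nonzero: "\<exists>v::'a. v \<noteq> 0"
    and L_pos: "L > 0"
    and f_convex: "convex_on UNIV f"
    and f_diff: "\<And>z. f differentiable (at z)"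
    and f_smooth: "L_smooth L f"
    and g_proper: "proper_fun g"
    and g_closed: "closed_fun g"
    and g_convex: "convex_fun g"
    and F_eq: "\<And>z. F z = ereal (f z) + g z"
    and N_ge: "N \<ge> 1"
    and R_nonneg: "R \<ge> 0"
    and optimal: "0 \<in> (\<lambda>v. gradient f xstar + v) ` subdifferential g xstar"
    and dist_le: "norm (x 0 - xstar) \<le> R"
    and y_init: "y 0 = x 0"
    and y_step: "\<And>k. k < N \<Longrightarrow>
      y (Suc k) = prox (1 / L) g (x k - (1 / L) *\<^sub>R gradient f (x k))"
    and x_step: "\<And>k. k < N \<Longrightarrow>
      x (Suc k) = y (Suc k) + (real k / (real k + 3)) *\<^sub>R (y (Suc k) - y k)"
  shows "F (y N) - F xstar \<le> ereal (2 * L * R\<^sup>2 / ((real N)\<^sup>2 + 5 * real N + 2))"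
proof -
  have grad: "GDERIV f z :> gradient f z" for z
    by (rule GDERIV_gradient[OF f_diff])
  have lip: "norm (gradient f z - gradient f w) \<le> L * norm (z - w)" for z w
    using f_smooth by (simp add: L_smooth_def)
  have not_minf: "g z \<noteq> - \<infinity>" for z using g_proper by (auto simp: proper_fun_def)
  obtain v where v: "v \<in> subdifferential g xstar" using optimal by auto
  obtain z0 where "g z0 \<noteq> \<infinity>" using g_proper by (auto simp: proper_fun_def)
  moreover have "g xstar + ereal (v \<bullet> (z0 - xstar)) \<le> g z0" using v by (simp add: subdifferential_def)
  ultimately have gstar: "\<bar>g xstar\<bar> \<noteq> \<infinity>" using not_minf[of xstar] by (cases "g xstar") auto
  define G where "G z = real_of_ereal (g z)" for z
  define \<sigma> where "\<sigma> k = L *\<^sub>R (x k - (1 / L) *\<^sub>R gradient f (x k) - y (Suc k))" for k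
  have g_y: "\<bar>g (y (Suc k))\<bar> \<noteq> \<infinity>" and sub: "\<sigma> k \<in> subdifferential g (y (Suc k))" if "k < N" for k
    using prox_subgradient[OF L_pos g_proper g_closed g_convex v, of "x k - (1 / L) *\<^sub>R gradient f (x k)"]
    by (simp_all add: y_step[OF that] \<sigma>_def)
  have G_sub: "G (y (Suc k)) + \<sigma> k \<bullet> (z - y (Suc k)) \<le> G z" if "k < N" "\<bar>g z\<bar> \<noteq> \<infinity>" for k z
  proof -
    have "g (y (Suc k)) + ereal (\<sigma> k \<bullet> (z - y (Suc k))) \<le> g z"
      using sub[OF that(1)] by (simp add: subdifferential_def)
    then show ?thesis
      using g_y[OF that(1)] that(2) unfolding G_def by (cases "g z"; cases "g (y (Suc k))") auto
  qed
  \<comment> \<open>Dividing values and slopes by \<open>L\<close> and measuring positions from \<open>xstar\<close> gives the normalised setting.\<close>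
  define u where "u k = (if k < N then x k else y k)" for k
  define \<gamma> where "\<gamma> k = (1 / L) *\<^sub>R gradient f (u k)" for k
  define s where "s k = (1 / L) *\<^sub>R \<sigma> k" for k
  have u_Suc: "u (Suc k) - xstar = (y (Suc k) - xstar)
      + (real k / (real k + 3)) *\<^sub>R ((y (Suc k) - xstar) - (y k - xstar))" if "Suc k < N" for k
    using that x_step[of k] by (simp add: u_def)
  have step: "y (Suc k) - xstar = (u k - xstar) - \<gamma> k - s k" if "k < N" for k
    using that L_pos by (simp add: u_def \<gamma>_def s_def \<sigma>_def)
  have f_star: "f (u j) / L - f xstar / L \<le> \<gamma> j \<bullet> (u j - xstar)" for j
  proof -
    have "f (u j) - f xstar \<le> gradient f (u j) \<bullet> (u j - xstar)"
      using convex_gradient_inequality[OF f_convex grad, of "u j" xstar] by (simp add: inner_diff_right)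
    then have "(f (u j) - f xstar) / L \<le> (gradient f (u j) \<bullet> (u j - xstar)) / L"
      using L_pos by (intro divide_right_mono) auto
    then show ?thesis by (simp add: \<gamma>_def diff_divide_distrib)
  qed
  have f_chain: "f (u (Suc j)) / L \<le> f (u j) / L + \<gamma> (Suc j) \<bullet> ((u (Suc j) - xstar) - (u j - xstar))
      - (norm (\<gamma> (Suc j) - \<gamma> j))\<^sup>2 / 2" for j
  proof -
    let ?d = "gradient f (u j) - gradient f (u (Suc j))"
    have "f (u (Suc j)) \<le> f (u j) + gradient f (u (Suc j)) \<bullet> (u (Suc j) - u j) - (norm ?d)\<^sup>2 / (2 * L)"
      using smooth_convex_interpolation[OF L_pos f_convex grad lip, of "u (Suc j)" "u j"]
      by (simp add: inner_diff_right)
    then have "f (u (Suc j)) / L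
        \<le> (f (u j) + gradient f (u (Suc j)) \<bullet> (u (Suc j) - u j) - (norm ?d)\<^sup>2 / (2 * L)) / L"
      using L_pos by (intro divide_right_mono) auto
    moreover have "\<gamma> (Suc j) - \<gamma> j = (- 1 / L) *\<^sub>R ?d"
      by (simp add: \<gamma>_def algebra_simps)
    then have "(norm (\<gamma> (Suc j) - \<gamma> j))\<^sup>2 / 2 = (norm ?d)\<^sup>2 / (2 * L) / L"
      by (simp add: power_divide power2_eq_square)
    ultimately show ?thesis
      by (simp add: \<gamma>_def add_divide_distrib diff_divide_distrib)
  qed
  have g_star: "G (y (Suc k)) / L - G xstar / L \<le> s k \<bullet> (y (Suc k) - xstar)" if "k < N" for k
  proof -
    have "G (y (Suc k)) - G xstar \<le> \<sigma> k \<bullet> (y (Suc k) - xstar)"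
      using G_sub[OF that gstar] by (simp add: inner_diff_right)
    then have "(G (y (Suc k)) - G xstar) / L \<le> \<sigma> k \<bullet> (y (Suc k) - xstar) / L"
      using L_pos by (intro divide_right_mono) auto
    then show ?thesis by (simp add: s_def diff_divide_distrib)
  qed
  have g_chain: "G (y (Suc (Suc k))) / L \<le> G (y (Suc k)) / L
      + s (Suc k) \<bullet> ((y (Suc (Suc k)) - xstar) - (y (Suc k) - xstar))" if "Suc k < N" for k
  proof -
    have "G (y (Suc (Suc k))) \<le> G (y (Suc k)) + \<sigma> (Suc k) \<bullet> (y (Suc (Suc k)) - y (Suc k))"
      using G_sub[OF that g_y[of k]] that by (simp add: inner_diff_right)
    then have "G (y (Suc (Suc k))) / L \<le> (G (y (Suc k)) + \<sigma> (Suc k) \<bullet> (y (Suc (Suc k)) - y (Suc k))) / L"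
      using L_pos by (intro divide_right_mono) auto
    then show ?thesis by (simp add: s_def add_divide_distrib)
  qed
  have "f (u N) / L + G (y (Suc (N - 1))) / L - (f xstar / L + G xstar / L)
      \<le> 2 / ((real N)\<^sup>2 + 5 * real N + 2) * (norm (u 0 - xstar))\<^sup>2"
  proof (rule composite_certificate[where u = "\<lambda>k. u k - xstar" and y = "\<lambda>k. y k - xstar"
        and \<gamma> = \<gamma> and s = s and \<phi> = "\<lambda>k. f (u k) / L" and \<psi> = "\<lambda>k. G (y (Suc k)) / L"])
    show "u 0 - xstar = y 0 - xstar" "u N - xstar = y N - xstar"
      using N_ge y_init by (simp_all add: u_def)
  qed ((fact N_ge u_Suc step)+, (rule f_star f_chain | erule g_star g_chain)+)
  also have "\<dots> \<le> 2 / ((real N)\<^sup>2 + 5 * real N + 2) * R\<^sup>2"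
    using N_ge dist_le by (intro mult_left_mono power_mono) (simp_all add: u_def)
  finally have "f (u N) / L + G (y (Suc (N - 1))) / L - (f xstar / L + G xstar / L)
      \<le> 2 / ((real N)\<^sup>2 + 5 * real N + 2) * R\<^sup>2" .
  moreover have "u N = y N" "Suc (N - 1) = N" using N_ge by (simp_all add: u_def)
  ultimately have "(f (y N) + G (y N) - (f xstar + G xstar)) / L \<le> 2 * R\<^sup>2 / ((real N)\<^sup>2 + 5 * real N + 2)"
    by (simp add: add_divide_distrib diff_divide_distrib)
  then have real_bound: "f (y N) + G (y N) - (f xstar + G xstar) \<le> 2 * L * R\<^sup>2 / ((real N)\<^sup>2 + 5 * real N + 2)"
    using L_pos by (simp add: pos_divide_le_eq mult_ac)
  have "g (y N) = ereal (G (y N))" "g xstar = ereal (G xstar)"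
    using g_y[of "N - 1"] N_ge gstar by (simp_all add: G_def ereal_real)
  then show ?thesis using real_bound by (simp add: F_eq)
qed

end
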